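(* Let $V_1\to V_2\to\cdots\to V_n$ be a persistence module over a field $K$, let $1\le p\le q\le n$, and let $V[p,q]$ be its restriction to $[p,q]$. Every monomorphism $I[p,q]\to V[p,q]$ splits. Equivalently, every fully supported interval submodule of $V[p,q]$ is a direct summand of $V[p,q]$.
   Context: Let $K$ be a field. A persistence module of length $n$ over $K$ is a sequence $V_1\xrightarrow{f_1}V_2\xrightarrow{f_2}\cdots\xrightarrow{f_{n-1}}V_n$ of finite-dimensional $K$-vector spaces and linear maps. Its restriction $V[p,q]$ keeps only the vector spaces and maps with indices between $p$ and $q$. Morphisms are families of linear maps commuting with the structure maps; a monomorphism is a morphism injective at every vertex; it splits if it admits a retraction, equivalently if its image is a direct summand. The interval module $I[p,q]$ has $K$ at each vertex $i$ with $p\le i\le q$ and $0$ elsewhere, with identity maps between consecutive nonzero spaces and zero maps otherwise. A submodule is a family of subspaces preserved by the structure maps; a submodule $W\subseteq V[p,q]$ is a direct summand if $V[p,q]=W\oplus W'$ for some submodule $W'$. A fully supported interval submodule of $V[p,q]$ is a submodule $W\cong I[p,q]$. *)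

theory Defs
  imports "Jordan_Normal_Form.Missing_VectorSpace"
begin

text \<open>
  The vertex set \<open>{first_vertex, \<dots>, last_vertex}\<close> is part of the data, so that a module and its
  restrictions are objects of the same kind. Only the values of \<open>vspace\<close> on the vertex set and of
  \<open>smap\<close> on \<open>{first_vertex..<last_vertex}\<close> are meaningful; \<open>smap V i\<close> maps vertex \<open>i\<close> to vertex
  \<open>Suc i\<close>. The spaces share a carrier type only; each has its own carrier set and operations, and
  may be any vector space up to isomorphism if the type is large enough.
\<close>

record ('a, 'b) pers_mod =
  first_vertex :: nat
  last_vertex :: nat
  vspace :: "nat \<Rightarrow> ('a, 'b) module"
  smap :: "nat \<Rightarrow> 'b \<Rightarrow> 'b"

definition persistence_module :: "('a, 'r) ring_scheme \<Rightarrow> ('a, 'b) pers_mod \<Rightarrow> bool" where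
  "persistence_module K V \<longleftrightarrow>
     (\<forall>i\<in>{first_vertex V..last_vertex V}. vectorspace K (vspace V i) \<and> vectorspace.fin_dim K (vspace V i)) \<and>
     (\<forall>i\<in>{first_vertex V..<last_vertex V}. linear_map K (vspace V i) (vspace V (Suc i)) (smap V i))"

definition persistence_module_of_length ::
    "('a, 'r) ring_scheme \<Rightarrow> nat \<Rightarrow> ('a, 'b) pers_mod \<Rightarrow> bool" where
  "persistence_module_of_length K n V \<longleftrightarrow> persistence_module K V \<and> first_vertex V = 1 \<and> last_vertex V = n"

text \<open>Meant for \<open>first_vertex V \<le> p\<close> and \<open>q \<le> last_vertex V\<close> only.\<close>

definition pm_restrict :: "('a, 'b) pers_mod \<Rightarrow> nat \<Rightarrow> nat \<Rightarrow> ('a, 'b) pers_mod" where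
  "pm_restrict V p q = V\<lparr>first_vertex := p, last_vertex := q\<rparr>"

definition pm_hom :: "('a, 'r) ring_scheme \<Rightarrow> ('a, 'b) pers_mod \<Rightarrow> ('a, 'c) pers_mod \<Rightarrow>
    (nat \<Rightarrow> 'b \<Rightarrow> 'c) \<Rightarrow> bool" where
  "pm_hom K V W \<phi> \<longleftrightarrow>
     first_vertex V = first_vertex W \<and> last_vertex V = last_vertex W \<and>
     (\<forall>i\<in>{first_vertex V..last_vertex V}. linear_map K (vspace V i) (vspace W i) (\<phi> i)) \<and>
     (\<forall>i\<in>{first_vertex V..<last_vertex V}. \<forall>x\<in>carrier (vspace V i).
        \<phi> (Suc i) (smap V i x) = smap W i (\<phi> i x))"

definition pm_mono :: "('a, 'r) ring_scheme \<Rightarrow> ('a, 'b) pers_mod \<Rightarrow> ('a, 'c) pers_mod \<Rightarrow>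
    (nat \<Rightarrow> 'b \<Rightarrow> 'c) \<Rightarrow> bool" where
  "pm_mono K V W \<phi> \<longleftrightarrow>
     pm_hom K V W \<phi> \<and> (\<forall>i\<in>{first_vertex V..last_vertex V}. inj_on (\<phi> i) (carrier (vspace V i)))"

definition pm_left_inverse :: "('a, 'b) pers_mod \<Rightarrow> (nat \<Rightarrow> 'c \<Rightarrow> 'b) \<Rightarrow> (nat \<Rightarrow> 'b \<Rightarrow> 'c) \<Rightarrow> bool" where
  "pm_left_inverse V \<rho> \<phi> \<longleftrightarrow>
     (\<forall>i\<in>{first_vertex V..last_vertex V}. \<forall>x\<in>carrier (vspace V i). \<rho> i (\<phi> i x) = x)"

definition pm_splits :: "('a, 'r) ring_scheme \<Rightarrow> ('a, 'b) pers_mod \<Rightarrow> ('a, 'c) pers_mod \<Rightarrow>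
    (nat \<Rightarrow> 'b \<Rightarrow> 'c) \<Rightarrow> bool" where
  "pm_splits K V W \<phi> \<longleftrightarrow> (\<exists>\<rho>. pm_hom K W V \<rho> \<and> pm_left_inverse V \<rho> \<phi>)"

definition pm_isomorphic ::
    "('a, 'r) ring_scheme \<Rightarrow> ('a, 'b) pers_mod \<Rightarrow> ('a, 'c) pers_mod \<Rightarrow> bool" where
  "pm_isomorphic K V W \<longleftrightarrow>
     (\<exists>\<phi> \<psi>. pm_hom K V W \<phi> \<and> pm_hom K W V \<psi> \<and> pm_left_inverse V \<psi> \<phi> \<and> pm_left_inverse W \<phi> \<psi>)"

text \<open>The \<open>mult\<close> and \<open>one\<close> fields of a \<open>module\<close> record carry no meaning for vector spaces.\<close>

definition field_space :: "('a, 'r) ring_scheme \<Rightarrow> ('a, 'a) module" where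
  "field_space K = \<lparr>carrier = carrier K, mult = mult K, one = one K, zero = zero K, add = add K,
     smult = mult K\<rparr>"

definition null_space :: "('a, 'r) ring_scheme \<Rightarrow> ('a, 'a) module" where
  "null_space K = (field_space K)\<lparr>carrier := {\<zero>\<^bsub>K\<^esub>}\<rparr>"

text \<open>The interval module \<open>I[p,q]\<close> on the vertex set \<open>{a, \<dots>, b}\<close>.\<close>

definition interval_module ::
    "('a, 'r) ring_scheme \<Rightarrow> nat \<Rightarrow> nat \<Rightarrow> nat \<Rightarrow> nat \<Rightarrow> ('a, 'a) pers_mod" where
  "interval_module K a b p q = \<lparr>first_vertex = a, last_vertex = b,
     vspace = (\<lambda>i. if p \<le> i \<and> i \<le> q then field_space K else null_space K),
     smap = (\<lambda>i. if p \<le> i \<and> Suc i \<le> q then (\<lambda>x. x) else (\<lambda>x. \<zero>\<^bsub>K\<^esub>))\<rparr>"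

definition pm_submodule :: "('a, 'r) ring_scheme \<Rightarrow> (nat \<Rightarrow> 'b set) \<Rightarrow> ('a, 'b) pers_mod \<Rightarrow> bool" where
  "pm_submodule K W V \<longleftrightarrow>
     (\<forall>i\<in>{first_vertex V..last_vertex V}. subspace K (W i) (vspace V i)) \<and>
     (\<forall>i\<in>{first_vertex V..<last_vertex V}. smap V i ` W i \<subseteq> W (Suc i))"

definition pm_sub :: "('a, 'b) pers_mod \<Rightarrow> (nat \<Rightarrow> 'b set) \<Rightarrow> ('a, 'b) pers_mod" where
  "pm_sub V W = V\<lparr>vspace := (\<lambda>i. (vspace V i)\<lparr>carrier := W i\<rparr>)\<rparr>"

definition pm_direct_summand ::
    "('a, 'r) ring_scheme \<Rightarrow> (nat \<Rightarrow> 'b set) \<Rightarrow> ('a, 'b) pers_mod \<Rightarrow> bool" where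
  "pm_direct_summand K W V \<longleftrightarrow> pm_submodule K W V \<and>
     (\<exists>W'. pm_submodule K W' V \<and>
        (\<forall>i\<in>{first_vertex V..last_vertex V}.
           module.submodule_sum (vspace V i) (W i) (W' i) = carrier (vspace V i) \<and>
           W i \<inter> W' i = {\<zero>\<^bsub>vspace V i\<^esub>}))"

definition fully_supported_interval_submodule ::
    "('a, 'r) ring_scheme \<Rightarrow> (nat \<Rightarrow> 'b set) \<Rightarrow> ('a, 'b) pers_mod \<Rightarrow> bool" where
  "fully_supported_interval_submodule K W V \<longleftrightarrow> pm_submodule K W V \<and>
     pm_isomorphic K (pm_sub V W)
       (interval_module K (first_vertex V) (last_vertex V) (first_vertex V) (last_vertex V))"

lemma persistence_module_restrict:
  assumes "persistence_module K V" "first_vertex V \<le> p" "q \<le> last_vertex V"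
  shows "persistence_module K (pm_restrict V p q)"
  using assms by (auto simp: persistence_module_def pm_restrict_def)

lemma vectorspace_field_space: "field K \<Longrightarrow> vectorspace K (field_space K)"
proof -
  assume "field K"
  then interpret field K .
  show ?thesis
    by (rule vs_criteria) (auto simp: field_space_def m_assoc a_ac l_distr r_distr intro: field_axioms r_neg)
qed

lemma subspace_null_space:
  assumes "field K" shows "subspace K {\<zero>\<^bsub>K\<^esub>} (field_space K)"
proof -
  interpret field K by fact
  interpret F: vectorspace K "field_space K" by (rule vectorspace_field_space) fact
  show ?thesis
    by (auto simp: subspace_def submodule_def F.vectorspace_axioms F.module_axioms)
       (auto simp: field_space_def)
qed

lemma vectorspace_null_space: "field K \<Longrightarrow> vectorspace K (null_space K)"
  unfolding null_space_def
  by (intro vectorspace.subspace_is_vs vectorspace_field_space subspace_null_space)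

lemma fin_dim_field_space: assumes "field K" shows "vectorspace.fin_dim K (field_space K)"
proof -
  interpret field K by fact
  interpret F: vectorspace K "field_space K" by (rule vectorspace_field_space) fact
  have 1: "\<one>\<^bsub>K\<^esub> \<in> carrier (field_space K)" by (simp add: field_space_def)
  have "F.lincomb (\<lambda>_. x) {\<one>\<^bsub>K\<^esub>} = x" if x: "x \<in> carrier K" for x
  proof -
    have x': "x \<in> carrier (field_space K)" using x by (simp add: field_space_def)
    have eq: "x \<odot>\<^bsub>field_space K\<^esub> \<one>\<^bsub>K\<^esub> = x" using x by (simp add: field_space_def)
    have "F.lincomb (\<lambda>_. x) {\<one>\<^bsub>K\<^esub>} =
        x \<odot>\<^bsub>field_space K\<^esub> \<one>\<^bsub>K\<^esub> \<oplus>\<^bsub>field_space K\<^esub>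
        (\<Oplus>\<^bsub>field_space K\<^esub>v\<in>{}. x \<odot>\<^bsub>field_space K\<^esub> v)"
      unfolding F.lincomb_def by (rule F.M.finsum_insert) (use 1 x in auto)
    also have "\<dots> = x" unfolding eq F.M.finsum_empty by (rule F.M.r_zero) (rule x')
    finally show ?thesis .
  qed
  note lc = this
  have "carrier (field_space K) \<subseteq> F.span {\<one>\<^bsub>K\<^esub>}"
  proof
    fix x assume "x \<in> carrier (field_space K)"
    then have x: "x \<in> carrier K" by (simp add: field_space_def)
    show "x \<in> F.span {\<one>\<^bsub>K\<^esub>}"
      unfolding F.span_def
      by (rule CollectI, rule exI[of _ "\<lambda>_. x"], rule exI[of _ "{\<one>\<^bsub>K\<^esub>}"])
         (simp add: lc[OF x] x)
  qed
  moreover have "{\<one>\<^bsub>K\<^esub>} \<subseteq> carrier (field_space K)" by (auto simp: field_space_def)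
  ultimately show ?thesis
    unfolding F.fin_dim_def using F.span_is_subset2[of "{\<one>\<^bsub>K\<^esub>}"]
    by (intro exI[of _ "{\<one>\<^bsub>K\<^esub>}"]) simp
qed

lemma fin_dim_null_space: assumes "field K" shows "vectorspace.fin_dim K (null_space K)"
proof -
  interpret N: vectorspace K "null_space K" by (rule vectorspace_null_space) fact
  have c: "carrier (null_space K) = {\<zero>\<^bsub>K\<^esub>}" by (simp add: null_space_def)
  show ?thesis
    unfolding N.fin_dim_def
    by (rule exI[of _ "carrier (null_space K)"])
       (use N.in_own_span N.span_is_subset2 c in auto)
qed

lemma persistence_module_interval_module:
  assumes "field K" shows "persistence_module K (interval_module K a b p q)"
proof -
  interpret field K by fact
  show ?thesis
    using assms
    by (auto simp: persistence_module_def interval_module_def vectorspace_field_space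
        vectorspace_null_space fin_dim_field_space fin_dim_null_space linear_map_def mod_hom_def
        mod_hom_axioms_def module_hom_def dest: vectorspace.axioms(1)[OF vectorspace_field_space]
        vectorspace.axioms(1)[OF vectorspace_null_space])
       (auto simp: field_space_def null_space_def)
qed

lemma pm_restrict_interval_module:
  "pm_restrict (interval_module K a b p q) p q = interval_module K p q p q"
  by (simp add: pm_restrict_def interval_module_def)

end

(*
  A monomorphism from I[p,q] is determined by the images v_i of 1, which are nonzero and satisfy
  f_i v_i = v_(i+1). Choose a linear functional on V_q with value 1 at v_q and pull it back along
  the structure maps: the pullbacks commute with the structure maps by construction and take the
  value 1 at every v_i, so they form a retraction. The kernel of a retraction is a complement.
*)
theory Submission
  imports Defs
begin

text \<open>In a finite basis, \<open>v\<close> has some nonzero coordinate because \<open>v\<close>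
  is nonzero. That coordinate function is linear, and dividing it by its value at \<open>v\<close>
  normalizes it.\<close>

lemma (in vectorspace) exists_linear_functional:
  assumes "fin_dim" and v: "v \<in> carrier V" "v \<noteq> \<zero>\<^bsub>V\<^esub>"
  shows "\<exists>f. linear_map K V (field_space K) f \<and> f v = \<one>\<^bsub>K\<^esub>"
proof -
  obtain B where B: "finite B" "basis B"
    using finite_basis_exists assms(1) by blast
  then have BV: "B \<subseteq> carrier V"
    by (simp add: basis_def)
  \<comment> \<open>The extensional function space \<open>B \<rightarrow>\<^sub>E carrier K\<close>
    fixes the values off \<open>B\<close>, so the coefficient function is unique and
    \<open>THE\<close> is well defined for \<open>x\<close> in the carrier.\<close>
  define coord where "coord x = (THE a. a \<in> B \<rightarrow>\<^sub>E carrier K \<and> lincomb a B = x)" for x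
  have unique: "\<exists>!a. a \<in> B \<rightarrow>\<^sub>E carrier K \<and> lincomb a B = x" if "x \<in> carrier V" for x
    using basis_criterion[OF B(1) BV] B(2) that by blast
  have coord: "coord x \<in> B \<rightarrow>\<^sub>E carrier K" "lincomb (coord x) B = x" if "x \<in> carrier V" for x
    using theI'[OF unique[OF that]] by (simp_all add: coord_def)
  \<comment> \<open>Coordinates can be read off from any expansion over \<open>B\<close>,
    extensional or not: restricting it to \<open>B\<close> gives the unique one. Linearity of
    \<open>coord\<close> in \<open>x\<close> then follows by adding or scaling expansions.\<close>
  have coord_eq: "coord x b = a b"
    if a: "a \<in> B \<rightarrow> carrier K" "lincomb a B = x" and b: "b \<in> B" for x a b
  proof -
    have "lincomb (restrict a B) B = x"
      using a BV lincomb_cong[of B B "restrict a B" a] by simp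
    moreover have "x \<in> carrier V"
      using a BV by auto
    moreover have "restrict a B \<in> B \<rightarrow>\<^sub>E carrier K"
      using a(1) by auto
    ultimately have "coord x = restrict a B"
      unfolding coord_def by (intro the1_equality unique) auto
    then show ?thesis
      using b by simp
  qed
  have in_K: "coord x b \<in> carrier K" if "x \<in> carrier V" "b \<in> B" for x b
    using coord(1)[OF that(1)] that(2) by auto
  have "\<exists>b\<in>B. coord v b \<noteq> \<zero>\<^bsub>K\<^esub>"
  proof (rule ccontr)
    assume "\<not> ?thesis"
    then have "lincomb (coord v) B = \<zero>\<^bsub>V\<^esub>"
      using BV by (intro lincomb_zero) auto
    with coord(2)[OF v(1)] v(2) show False
      by simp
  qed
  then obtain b where b: "b \<in> B" "coord v b \<noteq> \<zero>\<^bsub>K\<^esub>"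
    by blast
  define c where "c = inv\<^bsub>K\<^esub> (coord v b)"
  have unit: "coord v b \<in> Units K"
    using b in_K[OF v(1)] by (simp add: field_Units)
  then have c: "c \<in> carrier K" "c \<otimes>\<^bsub>K\<^esub> coord v b = \<one>\<^bsub>K\<^esub>"
    by (simp_all add: c_def)
  have add: "coord (x \<oplus>\<^bsub>V\<^esub> y) b = coord x b \<oplus>\<^bsub>K\<^esub> coord y b"
    if "x \<in> carrier V" "y \<in> carrier V" for x y
    using coord[OF that(1)] coord[OF that(2)] B(1) BV b(1) in_K that
    by (intro coord_eq) (auto simp: lincomb_sum)
  have smult: "coord (r \<odot>\<^bsub>V\<^esub> x) b = r \<otimes>\<^bsub>K\<^esub> coord x b"
    if "r \<in> carrier K" "x \<in> carrier V" for r x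
    using coord[OF that(2)] BV b(1) in_K that
    by (intro coord_eq) (auto simp: lincomb_smult)
  interpret F: vectorspace K "field_space K"
    by (rule vectorspace_field_space) unfold_locales
  have "linear_map K V (field_space K) (\<lambda>x. c \<otimes>\<^bsub>K\<^esub> coord x b)"
  proof unfold_locales
    show "(\<lambda>x. c \<otimes>\<^bsub>K\<^esub> coord x b) \<in> module_hom K V (field_space K)"
      using c(1) in_K[OF _ b(1)]
      by (auto simp: module_hom_def field_space_def add smult R.r_distr R.m_lcomm)
  qed
  with c(2) show ?thesis
    by blast
qed

lemma linear_map_compose:
  assumes "linear_map K U V f" "linear_map K V W g"
  shows "linear_map K U W (\<lambda>x. g (f x))"
proof -
  interpret f: linear_map K U V f by fact
  interpret g: linear_map K V W g by fact
  show ?thesis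
    by unfold_locales (auto simp: module_hom_def)
qed

text \<open>A subspace shares the operations of the ambient space. This turns the components of an
  isomorphism onto \<open>pm_sub V W\<close> into maps to \<open>V\<close> itself.\<close>

lemma linear_map_into_superspace:
  assumes "linear_map K U (V\<lparr>carrier := N\<rparr>) f" "subspace K N V"
  shows "linear_map K U V f"
proof -
  interpret f: linear_map K U "V\<lparr>carrier := N\<rparr>" f by fact
  interpret V: vectorspace K V
    using assms(2) by (simp add: subspace_def)
  have "N \<subseteq> carrier V"
    using assms(2) by (simp add: subspace_def submodule_def)
  then show ?thesis
    using f.f_hom by unfold_locales (auto simp: module_hom_def)
qed

lemma interval_mono_splits:
  fixes V :: "('a, 'b) pers_mod"
  assumes "field K" "persistence_module K V"
    and pq: "first_vertex V = p" "last_vertex V = q" "p \<le> q"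
    and mono: "pm_mono K (interval_module K p q p q) V \<phi>"
  shows "pm_splits K (interval_module K p q p q) V \<phi>"
proof -
  interpret field K by fact
  have space: "vectorspace K (vspace V i)" "vectorspace.fin_dim K (vspace V i)"
    if "p \<le> i" "i \<le> q" for i
    using assms that by (auto simp: persistence_module_def)
  have smap: "linear_map K (vspace V i) (vspace V (Suc i)) (smap V i)" if "p \<le> i" "i < q" for i
    using assms that by (auto simp: persistence_module_def)
  have \<phi>: "linear_map K (field_space K) (vspace V i) (\<phi> i)" "inj_on (\<phi> i) (carrier K)"
    if "p \<le> i" "i \<le> q" for i
    using mono that by (auto simp: pm_mono_def pm_hom_def interval_module_def field_space_def)
  have \<phi>_smap: "smap V i (\<phi> i a) = \<phi> (Suc i) a" if "p \<le> i" "i < q" "a \<in> carrier K" for i a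
    using mono that by (auto simp: pm_mono_def pm_hom_def interval_module_def field_space_def)

  interpret Vq: vectorspace K "vspace V q" using space pq by simp
  interpret \<phi>q: linear_map K "field_space K" "vspace V q" "\<phi> q" using \<phi> pq by simp
  have one: "\<one>\<^bsub>K\<^esub> \<in> carrier (field_space K)" and zero: "\<zero>\<^bsub>field_space K\<^esub> = \<zero>\<^bsub>K\<^esub>"
    by (simp_all add: field_space_def)
  \<comment> \<open>Injectivity at the last vertex makes the image of 1 nonzero there, which the
    choice of the functional \<open>f\<close> requires.\<close>
  have "\<phi> q \<one>\<^bsub>K\<^esub> \<noteq> \<phi> q \<zero>\<^bsub>K\<^esub>"
    using \<phi>(2)[of q] pq by (auto dest: inj_onD)
  then have "\<phi> q \<one>\<^bsub>K\<^esub> \<noteq> \<zero>\<^bsub>vspace V q\<^esub>"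
    using \<phi>q.f0_is_0 zero by simp
  then obtain f where f: "linear_map K (vspace V q) (field_space K) f" "f (\<phi> q \<one>\<^bsub>K\<^esub>) = \<one>\<^bsub>K\<^esub>"
    using Vq.exists_linear_functional space(2)[of q] pq \<phi>q.f_im[OF one] by auto
  interpret f: linear_map K "vspace V q" "field_space K" f by fact
  \<comment> \<open>The fold applies the structure maps at \<open>i, ..., q - 1\<close> in this
    order. At \<open>i = q\<close> the list is empty, which leaves \<open>f\<close>.\<close>
  define \<rho> where "\<rho> i x = f (fold (smap V) [i..<q] x)" for i x
  have \<rho>_q: "\<rho> q = f"
    by (simp add: \<rho>_def fun_eq_iff)
  have \<rho>_step: "\<rho> i = (\<lambda>x. \<rho> (Suc i) (smap V i x))" if "i < q" for i
    using that by (simp add: \<rho>_def fun_eq_iff upt_conv_Cons)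
  have \<rho>_linear: "linear_map K (vspace V i) (field_space K) (\<rho> i)" if "i \<le> q" "p \<le> i" for i
    using that
  proof (induction i rule: inc_induct)
    case base
    then show ?case using f(1) \<rho>_q by simp
  next
    case (step i)
    then show ?case
      using linear_map_compose[OF smap[of i]] \<rho>_step[of i] by simp
  qed
  \<comment> \<open>Downward induction from \<open>q\<close>. At \<open>q\<close>, linearity reduces
    the claim to \<open>a = 1\<close>; below \<open>q\<close>, one structure map carries
    \<open>\<phi> i a\<close> to \<open>\<phi> (Suc i) a\<close>.\<close>
  have "\<rho> i (\<phi> i a) = a" if "i \<le> q" "p \<le> i" "a \<in> carrier K" for i a
    using that
  proof (induction i rule: inc_induct)
    case base
    have "\<phi> q a = a \<odot>\<^bsub>vspace V q\<^esub> \<phi> q \<one>\<^bsub>K\<^esub>"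
      using \<phi>q.f_smult[OF base(2) one] base by (simp add: field_space_def)
    then have "f (\<phi> q a) = a \<odot>\<^bsub>field_space K\<^esub> \<one>\<^bsub>K\<^esub>"
      using f.f_smult[OF base(2) \<phi>q.f_im[OF one]] f(2) by simp
    then show ?case
      using base \<rho>_q by (simp add: field_space_def)
  next
    case (step i)
    then show ?case
      using \<rho>_step[of i] \<phi>_smap[of i a] by simp
  qed
  then have "pm_left_inverse (interval_module K p q p q) \<rho> \<phi>"
    by (auto simp: pm_left_inverse_def interval_module_def field_space_def)
  \<comment> \<open>The structure maps of the interval module are identities between
    \<open>p\<close> and \<open>q\<close>, so commutation is exactly
    \<open>\<rho>_step\<close>.\<close>
  moreover have "pm_hom K V (interval_module K p q p q) \<rho>"
    using pq \<rho>_linear \<rho>_step by (auto simp: pm_hom_def interval_module_def)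
  ultimately show ?thesis
    by (auto simp: pm_splits_def)
qed

text \<open>The kernel of \<open>\<rho>\<close> is the complement: surjectivity on \<open>W\<close>
  makes the two span, and injectivity on \<open>W\<close> makes them meet only in zero.\<close>

lemma direct_summand_if_bij_betw:
  fixes V :: "('a, 'b) pers_mod"
  assumes "persistence_module K V" and sub: "pm_submodule K W V" and hom: "pm_hom K V U \<rho>"
    and U: "\<And>i. i \<in> {first_vertex U..<last_vertex U} \<Longrightarrow>
      linear_map K (vspace U i) (vspace U (Suc i)) (smap U i)"
    and bij: "\<And>i. i \<in> {first_vertex V..last_vertex V} \<Longrightarrow>
      bij_betw (\<rho> i) (W i) (carrier (vspace U i))"
  shows "pm_direct_summand K W V"
proof -
  define W' where "W' i = {x \<in> carrier (vspace V i). \<rho> i x = \<zero>\<^bsub>vspace U i\<^esub>}" for i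
  have vertices: "first_vertex V = first_vertex U" "last_vertex V = last_vertex U"
    using hom by (simp_all add: pm_hom_def)
  have \<rho>: "linear_map K (vspace V i) (vspace U i) (\<rho> i)"
    if "i \<in> {first_vertex V..last_vertex V}" for i
    using hom that by (simp add: pm_hom_def)
  have W: "subspace K (W i) (vspace V i)" if "i \<in> {first_vertex V..last_vertex V}" for i
    using sub that by (simp add: pm_submodule_def)
  have "subspace K (W' i) (vspace V i)" if "i \<in> {first_vertex V..last_vertex V}" for i
  proof -
    interpret linear_map K "vspace V i" "vspace U i" "\<rho> i" using \<rho> that by simp
    show ?thesis
      using kerT_is_subspace by (simp add: W'_def ker_def)
  qed
  moreover have "smap V i ` W' i \<subseteq> W' (Suc i)" if i: "i \<in> {first_vertex V..<last_vertex V}" for i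
  proof -
    interpret s: linear_map K "vspace V i" "vspace V (Suc i)" "smap V i"
      using assms(1) i by (simp add: persistence_module_def)
    interpret t: linear_map K "vspace U i" "vspace U (Suc i)" "smap U i"
      using U i vertices by simp
    have "\<rho> (Suc i) (smap V i x) = smap U i (\<rho> i x)" if "x \<in> carrier (vspace V i)" for x
      using hom i that by (simp add: pm_hom_def)
    \<comment> \<open>The structure maps of \<open>U\<close> send zero to zero, so those of
      \<open>V\<close> preserve the kernels.\<close>
    then show ?thesis
      by (auto simp: W'_def)
  qed
  ultimately have sub': "pm_submodule K W' V"
    by (simp add: pm_submodule_def)
  have "module.submodule_sum (vspace V i) (W i) (W' i) = carrier (vspace V i) \<and>
      W i \<inter> W' i = {\<zero>\<^bsub>vspace V i\<^esub>}"
    if i: "i \<in> {first_vertex V..last_vertex V}" for i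
  proof -
    interpret linear_map K "vspace V i" "vspace U i" "\<rho> i" using \<rho> i by simp
    interpret S: submodule K "W i" "vspace V i" using W[OF i] by (simp add: subspace_def)
    note b = bij[OF i]
    \<comment> \<open>Take \<open>w\<close> in \<open>W i\<close> with the same image as
      \<open>x\<close>; the difference \<open>x - w\<close> lies in the kernel.\<close>
    have "\<exists>w\<in>W i. \<exists>w'\<in>W' i. x = w \<oplus>\<^bsub>vspace V i\<^esub> w'" if x: "x \<in> carrier (vspace V i)" for x
    proof -
      have "\<rho> i x \<in> carrier (vspace U i)"
        using x by simp
      then obtain w where w: "w \<in> W i" "\<rho> i w = \<rho> i x"
        using b by (metis bij_betw_imp_surj_on imageE)
      have wV: "w \<in> carrier (vspace V i)"
        using w(1) S.subset by blast
      have "x \<ominus>\<^bsub>vspace V i\<^esub> w \<in> W' i"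
        using x wV w(2) by (simp add: W'_def W.module.M.r_neg a_minus_def)
      moreover have "x = w \<oplus>\<^bsub>vspace V i\<^esub> (x \<ominus>\<^bsub>vspace V i\<^esub> w)"
        using x wV V.module.M.a_lcomm[of w x "\<ominus>\<^bsub>vspace V i\<^esub> w"]
        by (simp add: a_minus_def V.module.M.r_neg)
      ultimately show ?thesis
        using w(1) by blast
    qed
    then have "V.module.submodule_sum (W i) (W' i) = carrier (vspace V i)"
      using S.subset by (auto simp: V.module.submodule_sum_def W'_def image_iff)
    moreover have "x = \<zero>\<^bsub>vspace V i\<^esub>" if "x \<in> W i" "x \<in> W' i" for x
      using that S.zero_closed f0_is_0 by (intro inj_onD[OF bij_betw_imp_inj_on[OF b]]) (auto simp: W'_def)
    ultimately show ?thesis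
      by (auto simp: W'_def)
  qed
  with sub sub' show ?thesis
    unfolding pm_direct_summand_def by blast
qed

text \<open>The isomorphism from the interval module onto \<open>W\<close>, followed by the
  inclusion, is a monomorphism with image \<open>W\<close>. A retraction of it is bijective on
  \<open>W\<close> at every vertex, so its kernel is a complement.\<close>

lemma fully_supported_interval_submodule_is_direct_summand:
  fixes V :: "('a, 'b) pers_mod"
  assumes "field K" "persistence_module K V" "first_vertex V \<le> last_vertex V"
    and W: "fully_supported_interval_submodule K W V"
  shows "pm_direct_summand K W V"
proof -
  define I where
    "I = interval_module K (first_vertex V) (last_vertex V) (first_vertex V) (last_vertex V)"
  have sub: "pm_submodule K W V"
    using W by (simp add: fully_supported_interval_submodule_def)
  obtain \<phi> \<psi> where \<phi>: "pm_hom K (pm_sub V W) I \<phi>" and \<psi>: "pm_hom K I (pm_sub V W) \<psi>"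
    and inverse: "pm_left_inverse (pm_sub V W) \<psi> \<phi>" "pm_left_inverse I \<phi> \<psi>"
    using W by (auto simp: fully_supported_interval_submodule_def pm_isomorphic_def I_def)
  have [simp]: "first_vertex I = first_vertex V" "last_vertex I = last_vertex V"
    by (simp_all add: I_def interval_module_def)
  have "linear_map K (vspace I i) (vspace V i) (\<psi> i)"
    if "i \<in> {first_vertex V..last_vertex V}" for i
    by (rule linear_map_into_superspace[where N = "W i"])
       (use \<psi> sub that in \<open>auto simp: pm_hom_def pm_sub_def pm_submodule_def\<close>)
  then have "pm_hom K I V \<psi>"
    using \<psi> by (simp add: pm_hom_def pm_sub_def)
  moreover have "inj_on (\<psi> i) (carrier (vspace I i))"
    if "i \<in> {first_vertex V..last_vertex V}" for i
    using inverse(2) that by (intro inj_on_inverseI[of _ "\<phi> i"]) (simp add: pm_left_inverse_def)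
  ultimately have "pm_mono K I V \<psi>"
    by (simp add: pm_mono_def)
  then have "pm_splits K I V \<psi>"
    using interval_mono_splits[OF assms(1,2)] assms(3) by (simp add: I_def)
  then obtain \<rho> where \<rho>: "pm_hom K V I \<rho>" "pm_left_inverse I \<rho> \<psi>"
    by (auto simp: pm_splits_def)
  show ?thesis
  proof (rule direct_summand_if_bij_betw[OF assms(2) sub \<rho>(1)])
    show "linear_map K (vspace I i) (vspace I (Suc i)) (smap I i)"
      if "i \<in> {first_vertex I..<last_vertex I}" for i
      using persistence_module_interval_module[OF assms(1)] that
      by (auto simp: persistence_module_def I_def)
  next
    fix i assume i: "i \<in> {first_vertex V..last_vertex V}"
    have \<psi>_im: "\<psi> i \<in> carrier (vspace I i) \<rightarrow> W i"
      using \<psi> i mod_hom.f_im[of K "vspace I i" "vspace (pm_sub V W) i" "\<psi> i"]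
      by (auto simp: pm_hom_def linear_map_def pm_sub_def)
    have \<phi>_im: "\<phi> i \<in> W i \<rightarrow> carrier (vspace I i)"
      using \<phi> i mod_hom.f_im[of K "vspace (pm_sub V W) i" "vspace I i" "\<phi> i"]
      by (auto simp: pm_hom_def linear_map_def pm_sub_def)
    have \<psi>\<phi>: "\<psi> i (\<phi> i x) = x" if "x \<in> W i" for x
      using inverse(1) i that by (simp add: pm_left_inverse_def pm_sub_def)
    have \<rho>\<psi>: "\<rho> i (\<psi> i a) = a" if "a \<in> carrier (vspace I i)" for a
      using \<rho>(2) i that by (simp add: pm_left_inverse_def)
    \<comment> \<open>Every \<open>x\<close> in \<open>W i\<close> is
      \<open>\<psi> i (\<phi> i x)\<close>, and \<open>\<rho> i\<close> cancels
      \<open>\<psi> i\<close>. Hence the retraction extends the given isomorphism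
      \<open>\<phi>\<close> from \<open>W\<close> to all of \<open>V\<close>.\<close>
    have \<rho>_eq: "\<rho> i x = \<phi> i x" if "x \<in> W i" for x
      using \<psi>\<phi>[OF that] \<rho>\<psi>[of "\<phi> i x"] \<phi>_im that by auto
    show "bij_betw (\<rho> i) (W i) (carrier (vspace I i))"
      by (rule bij_betw_byWitness[of _ "\<psi> i"]) (use \<psi>_im \<phi>_im \<psi>\<phi> \<rho>\<psi> \<rho>_eq in auto)
  qed
qed

theorem corollary3p19:
  fixes K :: "('a, 'r) ring_scheme" and V :: "('a, 'b) pers_mod" and n p q :: nat
  assumes "field K"
    and "persistence_module_of_length K n V"
    and "1 \<le> p" and "p \<le> q" and "q \<le> n"
  shows "(\<forall>\<phi>. pm_mono K (interval_module K p q p q) (pm_restrict V p q) \<phi> \<longrightarrow>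
              pm_splits K (interval_module K p q p q) (pm_restrict V p q) \<phi>) \<and>
         (\<forall>W. fully_supported_interval_submodule K W (pm_restrict V p q) \<longrightarrow>
              pm_direct_summand K W (pm_restrict V p q))"
proof -
  \<comment> \<open>After restriction the whole vertex set is the interval from \<open>p\<close> to
    \<open>q\<close>, the setting of both preceding results.\<close>
  have "persistence_module K (pm_restrict V p q)"
    using assms by (intro persistence_module_restrict) (auto simp: persistence_module_of_length_def)
  moreover have "first_vertex (pm_restrict V p q) = p" "last_vertex (pm_restrict V p q) = q"
    by (simp_all add: pm_restrict_def)
  ultimately show ?thesis
    using assms(1,4) interval_mono_splits[of K "pm_restrict V p q"]
      fully_supported_interval_submodule_is_direct_summand[of K "pm_restrict V p q"]
    by simp
qed

end
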